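(* Let $m\in\mathbb{N}$ and let $\lambda\in\mathbb{R}$ satisfy $\frac{m+1}{m}\le\lambda<\frac{m}{m-1}$ (where for $m=1$ the upper bound is read as $+\infty$). Let $A:\mathbb{R}^2\to\mathbb{R}^2$ be given by $A(x,y)=(\lfloor\lambda y\rfloor,\lfloor\lambda x\rfloor)$. Then the following hold for $z=(x_0,y_0)\in\mathbb{R}^2$. (1) For every $k\in\{0,1,2,\dots,m-1\}$: if $z\in\{(x_0,y_0): \frac{k}{\lambda}\le x_0<\frac{k+1}{\lambda},\ y_0<0\}\cup\{(x_0,y_0): \frac{k}{\lambda}\le y_0<\frac{k+1}{\lambda},\ x_0<0\}$, then $\omega(z)=\{(k,-\infty),(-\infty,k)\}$. (2) If $z\in\{(x_0,y_0): x_0<0,\ y_0\ge\frac{m}{\lambda}\}\cup\{(x_0,y_0): y_0<0,\ x_0\ge\frac{m}{\lambda}\}$, then $\omega(z)=\{(\infty,-\infty),(-\infty,\infty)\}$. (3) For every $k\in\{0,1,2,\dots,m-1\}$ and $p\in\{0,1,2,\dots,m-1\}$: if $\frac{k}{\lambda}\le x_0<\frac{k+1}{\lambda}$ and $\frac{p}{\lambda}\le y_0<\frac{p+1}{\lambda}$, then $\omega(z)=\{(k,p),(p,k)\}$. (4) For every $k\in\{0,1,2,\dots,m-1\}$: if $z\in\{(x_0,y_0): \frac{k}{\lambda}\le x_0<\frac{k+1}{\lambda},\ y_0\ge\frac{m}{\lambda}\}\cup\{(x_0,y_0): \frac{k}{\lambda}\le y_0<\frac{k+1}{\lambda},\ x_0\ge\frac{m}{\lambda}\}$,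 then $\omega(z)=\{(k,\infty),(\infty,k)\}$. (5) If $x_0<0$ and $y_0<0$, then $\lim_{n\to\infty}A^n(z)=(-\infty,-\infty)$. (6) If $x_0\ge\frac{m}{\lambda}$ and $y_0\ge\frac{m}{\lambda}$, then $\lim_{n\to\infty}A^n(z)=(\infty,\infty)$.
   Context: $\mathbb{N}=\{1,2,3,\dots\}$. $\lfloor t\rfloor$ denotes the integer part (floor) of the real number $t$, i.e. the greatest integer $\le t$. $A^n$ denotes the $n$-fold composition of $A$ with itself. The $\omega$-limit set $\omega(z)$ is the set of limit points of the forward orbit $\{A^n(z)\}_{n\in\mathbb{N}}$: $w\in\omega(z)$ if and only if there is a strictly increasing sequence of natural numbers $\{n_k\}_{k\in\mathbb{N}}$ with $A^{n_k}(z)\to w$ as $k\to\infty$. Limits and limit points are allowed to have infinite coordinates: $w$ ranges over $[-\infty,\infty]^2$ and convergence is coordinatewise in the extended real line. *)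

theory Defs
  imports "HOL-Analysis.Analysis"
begin

definition floor_swap :: "real \<Rightarrow> real \<times> real \<Rightarrow> real \<times> real" where
  "floor_swap lam = (\<lambda>(x, y). (of_int \<lfloor>lam * y\<rfloor>, of_int \<lfloor>lam * x\<rfloor>))"

definition ereal_pair :: "real \<times> real \<Rightarrow> ereal \<times> ereal" where
  "ereal_pair = map_prod ereal ereal"

(* Limit points are taken in the product topology of the extended plane, i.e. coordinatewise,
   so they may have infinite coordinates.  The forward orbit starts with the first iterate:
   the times s j are positive. *)
definition omega_limit :: "(real \<times> real \<Rightarrow> real \<times> real) \<Rightarrow> real \<times> real \<Rightarrow> (ereal \<times> ereal) set" where
  "omega_limit T z =
     {w. \<exists>s :: nat \<Rightarrow> nat. strict_mono s \<and> (\<forall>j. 1 \<le> s j) \<and>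
           (\<lambda>j. ereal_pair ((T ^^ s j) z)) \<longlonglongrightarrow> w}"

end

theory Submission
  imports Defs "HOL-Real_Asymp.Real_Asymp"
begin

text \<open>
  Put g(x) = \<lfloor>\<lambda>x\<rfloor>. The n-th iterate of the map at (x, y) is (g^n x, g^n y) for even n and
  (g^n y, g^n x) for odd n, so if g^n x and g^n y converge to a and b in the extended reals,
  then the limit set is {(a, b), (b, a)}. The lower bound on \<lambda> makes each application of g move
  negative integers down and integers \<ge> m up by at least 1; the upper bound makes
  0, ..., m - 1 fixed points of g.
\<close>

definition floor_mult :: "real \<Rightarrow> real \<Rightarrow> real" where
  "floor_mult lam x = of_int \<lfloor>lam * x\<rfloor>"

lemma funpow_floor_swap:
  "(floor_swap lam ^^ n) (x, y) =
    (if even n then ((floor_mult lam ^^ n) x, (floor_mult lam ^^ n) y)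
     else ((floor_mult lam ^^ n) y, (floor_mult lam ^^ n) x))"
proof -
  have "floor_swap lam (a, b) = (floor_mult lam b, floor_mult lam a)" for a b
    by (simp add: floor_swap_def floor_mult_def)
  then show ?thesis by (induction n) auto
qed

text \<open>A subsequence of \<open>f\<close> may switch between \<open>p\<close> and
  \<open>q\<close> arbitrarily, so its limit cannot be read off from either one. Instead, a limit
  \<open>w\<close> distinct from \<open>a\<close> and \<open>b\<close> is separated from each by
  disjoint open sets; far along \<open>s\<close> the value \<open>f (s j)\<close> lies in both
  neighbourhoods of \<open>w\<close>, yet it equals a value that is already near \<open>a\<close> or
  near \<open>b\<close>.\<close>

lemma limit_point_of_two_sequences:
  fixes f p q :: "nat \<Rightarrow> 'a :: t2_space"
  assumes p: "p \<longlonglongrightarrow> a" and q: "q \<longlonglongrightarrow> b"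
    and f: "\<And>n. f n = p n \<or> f n = q n"
    and s: "strict_mono s" and w: "(\<lambda>j. f (s j)) \<longlonglongrightarrow> w"
  shows "w = a \<or> w = b"
proof (rule ccontr)
  assume "\<not> (w = a \<or> w = b)"
  then obtain U V U' V' where sep:
      "open U" "open V" "w \<in> U" "a \<in> V" "U \<inter> V = {}"
      "open U'" "open V'" "w \<in> U'" "b \<in> V'" "U' \<inter> V' = {}"
    using hausdorff[of w a] hausdorff[of w b] by metis
  have sub: "filterlim s at_top sequentially"
    using s by (rule filterlim_subseq)
  have "eventually (\<lambda>n. p n \<in> V) sequentially" "eventually (\<lambda>n. q n \<in> V') sequentially"
    using p q sep by (auto dest: topological_tendstoD)
  then have "eventually (\<lambda>j. p (s j) \<in> V) sequentially"
      "eventually (\<lambda>j. q (s j) \<in> V') sequentially"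
    using sub by (auto intro: eventually_compose_filterlim)
  moreover have "eventually (\<lambda>j. f (s j) \<in> U) sequentially"
      "eventually (\<lambda>j. f (s j) \<in> U') sequentially"
    using w sep by (auto dest: topological_tendstoD)
  ultimately have "eventually (\<lambda>j::nat. False) sequentially"
  proof eventually_elim
    case (elim j)
    then show ?case using f[of "s j"] sep by auto
  qed
  then show False by simp
qed

text \<open>Even times realise \<open>(a, b)\<close> and odd times \<open>(b, a)\<close>.
  Conversely, a strictly increasing sequence of times may mix parities, and the previous lemma
  excludes any third limit.\<close>

lemma omega_limit_floor_swap:
  assumes x: "(\<lambda>n. ereal ((floor_mult lam ^^ n) x)) \<longlonglongrightarrow> a"
    and y: "(\<lambda>n. ereal ((floor_mult lam ^^ n) y)) \<longlonglongrightarrow> b"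
  shows "omega_limit (floor_swap lam) (x, y) = {(a, b), (b, a)}"
proof -
  define u where "u n = ereal ((floor_mult lam ^^ n) x)" for n
  define v where "v n = ereal ((floor_mult lam ^^ n) y)" for n
  define f where "f n = ereal_pair ((floor_swap lam ^^ n) (x, y))" for n
  have f: "f n = (if even n then (u n, v n) else (v n, u n))" for n
    by (simp add: f_def u_def v_def funpow_floor_swap ereal_pair_def)
  have uv: "(\<lambda>n. (u n, v n)) \<longlonglongrightarrow> (a, b)" "(\<lambda>n. (v n, u n)) \<longlonglongrightarrow> (b, a)"
    using x y unfolding u_def v_def by (auto intro: tendsto_Pair)
  \<comment> \<open>Even times start at 2 because \<open>omega_limit\<close> admits positive times
    only.\<close>
  have mono: "strict_mono (\<lambda>j::nat. 2 * j + 2)" "strict_mono (\<lambda>j::nat. 2 * j + 1)"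
    by (auto intro: strict_monoI)
  have "(\<lambda>j. f (2 * j + 2)) \<longlonglongrightarrow> (a, b)" "(\<lambda>j. f (2 * j + 1)) \<longlonglongrightarrow> (b, a)"
    using LIMSEQ_subseq_LIMSEQ[OF uv(1) mono(1)] LIMSEQ_subseq_LIMSEQ[OF uv(2) mono(2)]
    by (simp_all add: f o_def)
  then have "\<exists>s. strict_mono s \<and> (\<forall>j. 1 \<le> s j) \<and> (\<lambda>j. f (s j)) \<longlonglongrightarrow> (a, b)"
      "\<exists>s. strict_mono s \<and> (\<forall>j. 1 \<le> s j) \<and> (\<lambda>j. f (s j)) \<longlonglongrightarrow> (b, a)"
    using mono by (force intro: exI[of _ "\<lambda>j. 2 * j + 2"], force intro: exI[of _ "\<lambda>j. 2 * j + 1"])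
  moreover have "w = (a, b) \<or> w = (b, a)" if "strict_mono s" "(\<lambda>j. f (s j)) \<longlonglongrightarrow> w" for w s
    using limit_point_of_two_sequences[OF uv, of f] f that by metis
  ultimately show ?thesis
    unfolding omega_limit_def f_def[symmetric] by blast
qed

text \<open>With a common limit the exchange of coordinates is harmless, so the whole orbit
  converges, not just its two parity subsequences.\<close>

lemma ereal_pair_floor_swap_tendsto:
  assumes x: "(\<lambda>n. ereal ((floor_mult lam ^^ n) x)) \<longlonglongrightarrow> a"
    and y: "(\<lambda>n. ereal ((floor_mult lam ^^ n) y)) \<longlonglongrightarrow> a"
  shows "(\<lambda>n. ereal_pair ((floor_swap lam ^^ n) (x, y))) \<longlonglongrightarrow> (a, a)"
proof -
  have "(\<lambda>n. if even n then (ereal ((floor_mult lam ^^ n) x), ereal ((floor_mult lam ^^ n) y))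
      else (ereal ((floor_mult lam ^^ n) y), ereal ((floor_mult lam ^^ n) x))) \<longlonglongrightarrow> (a, a)"
    \<comment> \<open>\<open>filterlim_If\<close> asks for limits along the even and the odd times
      separately; both filters lie below \<open>sequentially\<close>, so the coordinate limits
      restrict to them.\<close>
    by (intro filterlim_If tendsto_Pair) (auto intro: tendsto_mono[OF inf_le1] x y)
  then show ?thesis
    by (simp add: funpow_floor_swap ereal_pair_def if_distrib cong: if_cong)
qed

lemma floor_mult_tendsto_minus_infinity:
  assumes "1 < lam" "x < 0"
  shows "(\<lambda>n. ereal ((floor_mult lam ^^ n) x)) \<longlonglongrightarrow> -\<infinity>"
proof -
  \<comment> \<open>The bound starts at the first iterate, since \<open>x\<close> itself may lie in
    (-1, 0).\<close>
  have bound: "(floor_mult lam ^^ Suc n) x \<le> - real n - 1" for n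
  proof (induction n)
    case 0
    have "lam * x < 0" using assms by (simp add: mult_pos_neg)
    then have "\<lfloor>lam * x\<rfloor> \<le> - 1" by linarith
    then have "floor_mult lam x \<le> - 1" unfolding floor_mult_def by linarith
    then show ?case by simp
  next
    case (Suc n)
    define r where "r = (floor_mult lam ^^ Suc n) x"
    have r: "r \<le> - real n - 1" using Suc by (simp only: r_def)
    have "lam * r < r" using assms r by simp
    \<comment> \<open>\<open>lam * r\<close> is strictly below the integer -n - 1, so its floor
      drops by a full unit.\<close>
    then have "\<lfloor>lam * r\<rfloor> \<le> - int n - 2" using r by linarith
    then have "floor_mult lam r \<le> - real n - 2" unfolding floor_mult_def by linarith
    then show ?case by (simp add: r_def)
  qed
  have "filterlim (\<lambda>n::nat. - real n - 1) at_bot sequentially"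
    by real_asymp
  then have "filterlim (\<lambda>n. (floor_mult lam ^^ Suc n) x) at_bot sequentially"
    using bound by (auto intro: filterlim_at_bot_mono)
  then have "filterlim (\<lambda>n. (floor_mult lam ^^ n) x) at_bot sequentially"
    by (rule filterlim_sequentially_Suc[THEN iffD1])
  then show ?thesis
    by (simp add: tendsto_MInfty filterlim_at_bot_dense)
qed

lemma floor_mult_tendsto_infinity:
  assumes m: "1 \<le> m" and lam: "(real m + 1) / real m \<le> lam" and x: "real m / lam \<le> x"
  shows "(\<lambda>n. ereal ((floor_mult lam ^^ n) x)) \<longlonglongrightarrow> \<infinity>"
proof -
  have "0 < (real m + 1) / real m" using m by simp
  then have pos: "0 < lam" using lam by linarith
  \<comment> \<open>Again only iterates from the first on are bounded: \<open>x\<close> may be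
    smaller than \<open>m\<close>, but its image is not.\<close>
  have bound: "real m + real n \<le> (floor_mult lam ^^ Suc n) x" for n
  proof (induction n)
    case 0
    have "real m \<le> lam * x" using x pos by (simp add: field_simps)
    then have "int m \<le> \<lfloor>lam * x\<rfloor>" by linarith
    then have "real m \<le> floor_mult lam x" unfolding floor_mult_def by linarith
    then show ?case by simp
  next
    case (Suc n)
    define r where "r = (floor_mult lam ^^ Suc n) x"
    have r: "real m + real n \<le> r" using Suc by (simp only: r_def)
    \<comment> \<open>The right side is r + r/m, and r \<ge> m makes the second summand at least
      1.\<close>
    have "r + 1 \<le> (real m + 1) / real m * r" using r m by (simp add: field_simps)
    also have "\<dots> \<le> lam * r" using r lam by (intro mult_right_mono) auto
    finally have "int m + int n + 1 \<le> \<lfloor>lam * r\<rfloor>" using r by linarith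
    then have "real m + real n + 1 \<le> floor_mult lam r" unfolding floor_mult_def by linarith
    then show ?case by (simp add: r_def)
  qed
  have "filterlim (\<lambda>n::nat. real m + real n) at_top sequentially"
    by real_asymp
  then have "filterlim (\<lambda>n. (floor_mult lam ^^ Suc n) x) at_top sequentially"
    using bound by (auto intro: filterlim_at_top_mono)
  then have "filterlim (\<lambda>n. (floor_mult lam ^^ n) x) at_top sequentially"
    by (rule filterlim_sequentially_Suc[THEN iffD1])
  then show ?thesis by (simp only: tendsto_PInfty_eq_at_top)
qed

text \<open>The interval for \<open>x\<close> is exactly the set that one step sends to
  \<open>k\<close>, and \<open>k\<close> is fixed because k \<le> \<open>lam\<close> * k < k + 1. So
  the orbit is constant from the first iterate on.\<close>

lemma floor_mult_tendsto_fixed_point: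
  assumes lam: "1 \<le> lam" "m \<noteq> 1 \<Longrightarrow> lam < real m / (real m - 1)" and k: "k < m"
    and x: "real k / lam \<le> x" "x < (real k + 1) / lam"
  shows "(\<lambda>n. ereal ((floor_mult lam ^^ n) x)) \<longlonglongrightarrow> ereal (real k)"
proof -
  have "lam * real k < real k + 1"
  \<comment> \<open>A nonzero k < m forces m \<ge> 2, which makes the upper bound on
    \<open>lam\<close> available. It says (\<open>lam\<close> - 1) * (m - 1) < 1, hence
    (\<open>lam\<close> - 1) * k < 1. For m = 1 only k = 0 occurs.\<close>
  proof (cases "k = 0")
    case False
    then have "m \<noteq> 1" "0 < real m - 1" using k by auto
    then have *: "lam * (real m - 1) < real m" using lam by (simp add: field_simps)
    have "(lam - 1) * real k \<le> (lam - 1) * (real m - 1)"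
      using lam k by (intro mult_left_mono) auto
    with * show ?thesis by (simp add: algebra_simps)
  qed simp
  moreover have "real k \<le> lam * real k" using lam by (simp add: mult_le_cancel_right1)
  ultimately have "\<lfloor>lam * real k\<rfloor> = int k" by linarith
  then have fixed: "floor_mult lam (real k) = real k" by (simp add: floor_mult_def)
  have "real k \<le> lam * x" "lam * x < real k + 1" using x lam by (simp_all add: field_simps)
  then have "\<lfloor>lam * x\<rfloor> = int k" by linarith
  then have first: "floor_mult lam x = real k" by (simp add: floor_mult_def)
  have "(floor_mult lam ^^ Suc n) x = real k" for n
    by (induction n) (simp_all add: first fixed)
  then have "(\<lambda>n. ereal ((floor_mult lam ^^ Suc n) x)) \<longlonglongrightarrow> ereal (real k)" by simp
  then show ?thesis by (rule LIMSEQ_imp_Suc)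
qed

theorem theorem3:
  fixes m :: nat and lam x0 y0 :: real
    and A :: "real \<times> real \<Rightarrow> real \<times> real" and z :: "real \<times> real"
  assumes "1 \<le> m"
    and "(real m + 1) / real m \<le> lam"
    and "m \<noteq> 1 \<Longrightarrow> lam < real m / (real m - 1)"
    and "A = floor_swap lam"
    and "z = (x0, y0)"
  shows
    "(\<forall>k::nat. k < m \<longrightarrow>
        z \<in> {(x, y). real k / lam \<le> x \<and> x < (real k + 1) / lam \<and> y < 0} \<union>
            {(x, y). real k / lam \<le> y \<and> y < (real k + 1) / lam \<and> x < 0} \<longrightarrow>
        omega_limit A z = {(ereal (real k), -\<infinity>), (-\<infinity>, ereal (real k))}) \<and>
     (z \<in> {(x, y). x < 0 \<and> real m / lam \<le> y} \<union> {(x, y). y < 0 \<and> real m / lam \<le> x} \<longrightarrow>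
        omega_limit A z = {(\<infinity>, -\<infinity>), (-\<infinity>, \<infinity>)}) \<and>
     (\<forall>(k::nat) (p::nat). k < m \<longrightarrow> p < m \<longrightarrow>
        real k / lam \<le> x0 \<and> x0 < (real k + 1) / lam \<longrightarrow>
        real p / lam \<le> y0 \<and> y0 < (real p + 1) / lam \<longrightarrow>
        omega_limit A z =
          {(ereal (real k), ereal (real p)), (ereal (real p), ereal (real k))}) \<and>
     (\<forall>k::nat. k < m \<longrightarrow>
        z \<in> {(x, y). real k / lam \<le> x \<and> x < (real k + 1) / lam \<and> real m / lam \<le> y} \<union>
            {(x, y). real k / lam \<le> y \<and> y < (real k + 1) / lam \<and> real m / lam \<le> x} \<longrightarrow>
        omega_limit A z = {(ereal (real k), \<infinity>), (\<infinity>, ereal (real k))}) \<and>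
     (x0 < 0 \<and> y0 < 0 \<longrightarrow>
        (\<lambda>n. ereal_pair ((A ^^ n) z)) \<longlonglongrightarrow> (-\<infinity>, -\<infinity>)) \<and>
     (real m / lam \<le> x0 \<and> real m / lam \<le> y0 \<longrightarrow>
        (\<lambda>n. ereal_pair ((A ^^ n) z)) \<longlonglongrightarrow> (\<infinity>, \<infinity>))"
proof -
  have "1 < (real m + 1) / real m" using assms(1) by simp
  then have "1 < lam" using assms(2) by linarith
  note neg = floor_mult_tendsto_minus_infinity[OF this]
    and pos = floor_mult_tendsto_infinity[OF assms(1,2)]
    and fixed = floor_mult_tendsto_fixed_point[OF less_imp_le[OF \<open>1 < lam\<close>] assms(3)]
  \<comment> \<open>Each union also contains the points with the roles of the coordinates exchanged;
    there \<open>omega\<close> lists the two limit points in the opposite order.\<close>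
  note swap = insert_commute[of _ _ "{}"]
  note omega = omega_limit_floor_swap
  show ?thesis
    unfolding assms(4,5)
  proof (intro conjI allI impI, goal_cases)
    case (1 k)
    then show ?case using omega[OF fixed neg] omega[OF neg fixed] swap by blast
  next
    case 2
    then show ?case using omega[OF neg pos] omega[OF pos neg] swap by blast
  next
    case (3 k p)
    then show ?case using omega[OF fixed fixed] by blast
  next
    case (4 k)
    then show ?case using omega[OF fixed pos] omega[OF pos fixed] swap by blast
  next
    case 5
    then show ?case using ereal_pair_floor_swap_tendsto[OF neg neg] by blast
  next
    case 6
    then show ?case using ereal_pair_floor_swap_tendsto[OF pos pos] by blast
  qed
qed

end
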